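(* The linear (non-isothermal) Korteweg system $$A^0W_t+A^1W_x-BW_{xx}-CW_{xxx}=0$$ of the context is symbol symmetrizable but not symmetrizable in the sense of Friedrichs. One symbol symmetrizer is $$S(\xi)=\begin{pmatrix}\beta(\xi)/\overline p_\rho&0&0\\0&1&0\\0&0&1\end{pmatrix}\in C^\infty(\mathbb R;\mathbb R^{3\times3}),\qquad \beta(\xi):=\overline p_\rho+\xi^2\,\overline k\,\overline\rho .$$
   Context: $\overline\rho,\overline\theta,\overline p_\rho,\overline p_\theta,\overline e_\theta,\overline\mu,\overline\alpha,\overline k>0$ and $\overline u\in\mathbb R$ are constants: a constant state $\overline U=(\overline\rho,\overline u,\overline\theta)$ and the values at $(\overline\rho,\overline\theta)$ of the derivatives $p_\rho,p_\theta$ of the pressure, the derivative $e_\theta$ of the internal energy, the viscosity $\mu$, the heat conductivity $\alpha$ and the capillarity $k$. The matrices are $$A^0=\frac1{\overline\theta}\begin{pmatrix}\overline p_\rho/\overline\rho&0&0\\0&\overline\rho&0\\0&0&\overline e_\theta\overline\rho/\overline\theta\end{pmatrix},\quad A^1=\frac1{\overline\theta}\begin{pmatrix}\overline p_\rho\overline u/\overline\rho&\overline p_\rho&0\\\overline p_\rho&\overline\rho\,\overline u&\overline p_\theta\\0&\overline p_\theta&\overline\rho\,\overline u\,\overline e_\theta/\overline\theta\end{pmatrix},$$ $$B=\frac1{\overline\theta}\begin{pmatrix}0&0&0\\0&\overline\mu&0\\0&0&\overline\alpha/\overline\theta\end{pmatrix},\quad C=\frac1{\overline\theta}\begin{pmatrix}0&0&0\\\overline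 k\,\overline\rho&0&0\\0&0&0\end{pmatrix}.$$ The system is $A^0W_t=\mathcal LW:=-D_1W_x-D_2W_{xx}-D_3W_{xxx}$ with $D_1=A^1$, $D_2=-B$, $D_3=-C$. Its symbols are $A(\xi):=D_1-\xi^2D_3=A^1+\xi^2C$ and $B(\xi):=-\xi^2D_2=\xi^2B$, $\xi\in\mathbb R$. *Symmetrizable in the sense of Friedrichs*: for any constant state $\overline U$ there is a symmetric positive definite constant matrix $S=S(\overline U)$ such that $SA^0$, $SD_1$, $SD_2$, $SD_3$ are symmetric, with $SA^0$ positive definite. *Symbol symmetrizable* (in the sense of Humpherys): there is a smooth, symmetric, positive definite matrix-valued function $S=S(\xi)$ such that $S(\xi)A^0$, $S(\xi)A(\xi)$, $S(\xi)B(\xi)$ are symmetric, with $S(\xi)A^0>0$ and $S(\xi)B(\xi)\ge0$ (positive semi-definite) for all $\xi\in\mathbb R$; such an $S$ is called a symbol symmetrizer. *)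

theory Defs
  imports "HOL-Analysis.Analysis"
begin

definition sym_matrix :: "real^'n^'n \<Rightarrow> bool" where
  "sym_matrix M \<longleftrightarrow> transpose M = M"

definition pos_def_matrix :: "real^'n^'n \<Rightarrow> bool" where
  "pos_def_matrix M \<longleftrightarrow> sym_matrix M \<and> (\<forall>x. x \<noteq> 0 \<longrightarrow> x \<bullet> (M *v x) > 0)"

definition pos_semidef_matrix :: "real^'n^'n \<Rightarrow> bool" where
  "pos_semidef_matrix M \<longleftrightarrow> sym_matrix M \<and> (\<forall>x. x \<bullet> (M *v x) \<ge> 0)"

(* C^\<infinity> on the whole line: every iterated derivative is again differentiable everywhere. *)
definition smooth :: "(real \<Rightarrow> 'a::real_normed_vector) \<Rightarrow> bool" where
  "smooth f \<longleftrightarrow>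
     (\<forall>n x. ((\<lambda>g y. vector_derivative g (at y)) ^^ n) f differentiable (at x))"

(* The matrices A0, D1, D2, D3 below stand for the linear constant-coefficient system
     A0 W_t = - D1 W_x - D2 W_xx - D3 W_xxx,
   the linearization at one given constant state. A symmetrizer may depend on that state,
   so the property is stated for each such system separately. *)

definition friedrichs_symmetrizable ::
    "real^'n^'n \<Rightarrow> real^'n^'n \<Rightarrow> real^'n^'n \<Rightarrow> real^'n^'n \<Rightarrow> bool" where
  "friedrichs_symmetrizable A0 D1 D2 D3 \<longleftrightarrow>
     (\<exists>S. pos_def_matrix S \<and> pos_def_matrix (S ** A0) \<and>
          sym_matrix (S ** D1) \<and> sym_matrix (S ** D2) \<and> sym_matrix (S ** D3))"

definition symbol_A :: "real^'n^'n \<Rightarrow> real^'n^'n \<Rightarrow> real \<Rightarrow> real^'n^'n" where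
  "symbol_A D1 D3 \<xi> = D1 - \<xi>\<^sup>2 *\<^sub>R D3"

definition symbol_B :: "real^'n^'n \<Rightarrow> real \<Rightarrow> real^'n^'n" where
  "symbol_B D2 \<xi> = - (\<xi>\<^sup>2 *\<^sub>R D2)"

definition symbol_symmetrizer ::
    "real^'n^'n \<Rightarrow> real^'n^'n \<Rightarrow> real^'n^'n \<Rightarrow> real^'n^'n \<Rightarrow> (real \<Rightarrow> real^'n^'n) \<Rightarrow> bool" where
  "symbol_symmetrizer A0 D1 D2 D3 S \<longleftrightarrow>
     smooth S \<and>
     (\<forall>\<xi>. pos_def_matrix (S \<xi>) \<and>
          pos_def_matrix (S \<xi> ** A0) \<and>
          sym_matrix (S \<xi> ** symbol_A D1 D3 \<xi>) \<and>
          pos_semidef_matrix (S \<xi> ** symbol_B D2 \<xi>))"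

definition symbol_symmetrizable ::
    "real^'n^'n \<Rightarrow> real^'n^'n \<Rightarrow> real^'n^'n \<Rightarrow> real^'n^'n \<Rightarrow> bool" where
  "symbol_symmetrizable A0 D1 D2 D3 \<longleftrightarrow> (\<exists>S. symbol_symmetrizer A0 D1 D2 D3 S)"

definition korteweg_A0 :: "real \<Rightarrow> real \<Rightarrow> real \<Rightarrow> real \<Rightarrow> real^3^3" where
  "korteweg_A0 \<rho> \<theta> p\<^sub>\<rho> e\<^sub>\<theta> = (1 / \<theta>) *\<^sub>R vector [
     vector [p\<^sub>\<rho> / \<rho>, 0, 0],
     vector [0,      \<rho>, 0],
     vector [0,      0, e\<^sub>\<theta> * \<rho> / \<theta>]]"

definition korteweg_A1 :: "real \<Rightarrow> real \<Rightarrow> real \<Rightarrow> real \<Rightarrow> real \<Rightarrow> real \<Rightarrow> real^3^3" where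
  "korteweg_A1 \<rho> u \<theta> p\<^sub>\<rho> p\<^sub>\<theta> e\<^sub>\<theta> = (1 / \<theta>) *\<^sub>R vector [
     vector [p\<^sub>\<rho> * u / \<rho>, p\<^sub>\<rho>,    0],
     vector [p\<^sub>\<rho>,         \<rho> * u, p\<^sub>\<theta>],
     vector [0,          p\<^sub>\<theta>,    \<rho> * u * e\<^sub>\<theta> / \<theta>]]"

definition korteweg_B :: "real \<Rightarrow> real \<Rightarrow> real \<Rightarrow> real^3^3" where
  "korteweg_B \<theta> \<mu> \<alpha> = (1 / \<theta>) *\<^sub>R vector [
     vector [0, 0, 0],
     vector [0, \<mu>, 0],
     vector [0, 0, \<alpha> / \<theta>]]"

definition korteweg_C :: "real \<Rightarrow> real \<Rightarrow> real \<Rightarrow> real^3^3" where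
  "korteweg_C \<rho> \<theta> k = (1 / \<theta>) *\<^sub>R vector [
     vector [0,     0, 0],
     vector [k * \<rho>, 0, 0],
     vector [0,     0, 0]]"

definition korteweg_beta :: "real \<Rightarrow> real \<Rightarrow> real \<Rightarrow> real \<Rightarrow> real" where
  "korteweg_beta \<rho> p\<^sub>\<rho> k \<xi> = p\<^sub>\<rho> + \<xi>\<^sup>2 * k * \<rho>"

definition korteweg_S :: "real \<Rightarrow> real \<Rightarrow> real \<Rightarrow> real \<Rightarrow> real^3^3" where
  "korteweg_S \<rho> p\<^sub>\<rho> k \<xi> = vector [
     vector [korteweg_beta \<rho> p\<^sub>\<rho> k \<xi> / p\<^sub>\<rho>, 0, 0],
     vector [0, 1, 0],
     vector [0, 0, 1]]"

end

theory Submission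
  imports Defs
begin

text \<open>Everything rests on the single nonzero entry of \<open>C\<close>, at position (2,1). In
  \<open>A1 + \<xi>\<^sup>2 C\<close> it raises entry (2,1) to \<beta>/\<theta>, while entry (1,2)
  remains p/\<theta>. Scaling the first row by \<beta>/p restores the balance, because the other
  entry of that row is diagonal. As \<open>A0\<close> and \<open>B\<close> are diagonal, the same
  scaling keeps them diagonal with entries of the right sign; this is
  \<open>korteweg_S_symbol_symmetrizer\<close>. A Friedrichs symmetrizer has to work for
  \<open>C\<close> alone: entry (1,2) of \<open>S C\<close> vanishes with the second column of
  \<open>C\<close>, while entry (2,1) is the multiple k \<rho>/\<theta> of the diagonal entry of
  \<open>S\<close> at (2,2), which is positive. This contradiction is
  \<open>korteweg_not_friedrichs_symmetrizable\<close>.\<close>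

lemma smooth_quadratic:
  fixes a b c :: "'a::real_normed_vector"
  shows "smooth (\<lambda>x. a + x *\<^sub>R b + x\<^sup>2 *\<^sub>R c)"
  unfolding smooth_def
proof (intro allI)
  have deriv: "((\<lambda>x. a + x *\<^sub>R b + x\<^sup>2 *\<^sub>R c) has_vector_derivative b + x *\<^sub>R 2 *\<^sub>R c) (at x)"
    for a b c :: 'a and x
    by (auto intro!: derivative_eq_intros)
  \<comment> \<open>The derivative is written as a quadratic with leading coefficient 0, so that the
    induction over \<open>n\<close>, with the coefficients arbitrary, can be applied to it
    again.\<close>
  have vd: "(\<lambda>y. vector_derivative (\<lambda>x. a + x *\<^sub>R b + x\<^sup>2 *\<^sub>R c) (at y))
      = (\<lambda>x. b + x *\<^sub>R 2 *\<^sub>R c + x\<^sup>2 *\<^sub>R 0)" for a b c :: 'a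
    using vector_derivative_at[OF deriv, of a b c] by (simp only: scaleR_zero_right add_0_right)
  show "((\<lambda>g y. vector_derivative g (at y)) ^^ n) (\<lambda>x. a + x *\<^sub>R b + x\<^sup>2 *\<^sub>R c)
      differentiable (at x)" for n x
  proof (induction n arbitrary: a b c)
    case 0
    show ?case using differentiableI_vector[OF deriv] by simp
  next
    case (Suc n)
    show ?case unfolding funpow_Suc_right comp_def vd by (rule Suc)
  qed
qed

lemma smooth_korteweg_S: "smooth (korteweg_S \<rho> p k)"
proof -
  \<comment> \<open>Only entry (1,1) depends on \<xi>, and it is a quadratic in \<xi> without linear
    term.\<close>
  have "korteweg_S \<rho> p k = (\<lambda>\<xi>. korteweg_S \<rho> p k 0 + \<xi> *\<^sub>R 0
      + \<xi>\<^sup>2 *\<^sub>R vector [vector [k * \<rho> / p, 0, 0], 0, 0])"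
    by (auto simp: fun_eq_iff korteweg_S_def korteweg_beta_def vec_eq_iff forall_3 vector_3
        add_divide_distrib)
  then show ?thesis by (rule ssubst) (rule smooth_quadratic)
qed

lemma sym_matrix_3:
  fixes M :: "real^3^3"
  shows "sym_matrix M \<longleftrightarrow> M$1$2 = M$2$1 \<and> M$1$3 = M$3$1 \<and> M$2$3 = M$3$2"
  by (auto simp: sym_matrix_def transpose_def vec_eq_iff forall_3)

text \<open>Reduces definiteness of a diagonal matrix to the signs of its three diagonal
  entries.\<close>

lemma diagonal_3_quadratic_form:
  fixes M :: "real^3^3"
  assumes "\<And>i j. i \<noteq> j \<Longrightarrow> M$i$j = 0"
  shows "x \<bullet> (M *v x) = M$1$1 * (x$1)\<^sup>2 + M$2$2 * (x$2)\<^sup>2 + M$3$3 * (x$3)\<^sup>2"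
  using assms[of 1 2] assms[of 1 3] assms[of 2 1] assms[of 2 3] assms[of 3 1] assms[of 3 2]
  by (simp add: inner_vec_def matrix_vector_mult_def sum_3 power2_eq_square algebra_simps)

lemma pos_semidef_matrix_diagonal_3:
  fixes M :: "real^3^3"
  assumes "\<And>i j. i \<noteq> j \<Longrightarrow> M$i$j = 0" "M$1$1 \<ge> 0" "M$2$2 \<ge> 0" "M$3$3 \<ge> 0"
  shows "pos_semidef_matrix M"
  using assms(2-) by (simp add: pos_semidef_matrix_def sym_matrix_3 assms(1)
      diagonal_3_quadratic_form[OF assms(1)])

lemma pos_def_matrix_diagonal_3:
  fixes M :: "real^3^3"
  assumes "\<And>i j. i \<noteq> j \<Longrightarrow> M$i$j = 0" "M$1$1 > 0" "M$2$2 > 0" "M$3$3 > 0"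
  shows "pos_def_matrix M"
  unfolding pos_def_matrix_def
proof (intro conjI allI impI)
  show "sym_matrix M" by (simp add: sym_matrix_3 assms(1))
next
  fix x :: "real^3"
  assume "x \<noteq> 0"
  then have "x$1 \<noteq> 0 \<or> x$2 \<noteq> 0 \<or> x$3 \<noteq> 0"
    by (simp add: vec_eq_iff forall_3)
  then have "M$1$1 * (x$1)\<^sup>2 + M$2$2 * (x$2)\<^sup>2 + M$3$3 * (x$3)\<^sup>2 > 0"
    using assms(2-) by (elim disjE) (simp_all add: add_pos_nonneg add_nonneg_pos)
  then show "x \<bullet> (M *v x) > 0"
    by (simp add: diagonal_3_quadratic_form assms(1))
qed

text \<open>The diagonal entry is the value of the quadratic form at the standard basis vector
  \<open>axis i 1\<close>.\<close>

lemma pos_def_matrix_diag_pos: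
  fixes M :: "real^'n^'n"
  assumes "pos_def_matrix M"
  shows "M$i$i > 0"
proof -
  have "axis i 1 \<bullet> (M *v axis i 1) > 0"
    using assms by (simp add: pos_def_matrix_def axis_eq_0_iff)
  then show ?thesis
    by (simp add: inner_axis' matrix_vector_mult_basis column_def)
qed

lemma korteweg_S_symbol_symmetrizer:
  fixes \<rho> u \<theta> p q e \<mu> \<alpha> k :: real
  assumes "\<rho> > 0" "\<theta> > 0" "p > 0" "e > 0" "\<mu> \<ge> 0" "\<alpha> \<ge> 0" "k \<ge> 0"
  shows "symbol_symmetrizer (korteweg_A0 \<rho> \<theta> p e) (korteweg_A1 \<rho> u \<theta> p q e)
           (- korteweg_B \<theta> \<mu> \<alpha>) (- korteweg_C \<rho> \<theta> k) (korteweg_S \<rho> p k)"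
  unfolding symbol_symmetrizer_def
proof (intro conjI allI)
  show "smooth (korteweg_S \<rho> p k)" by (rule smooth_korteweg_S)
next
  fix \<xi> :: real
  let ?S = "korteweg_S \<rho> p k \<xi>"
  have beta: "korteweg_beta \<rho> p k \<xi> > 0"
    using assms by (auto simp: korteweg_beta_def intro!: add_pos_nonneg mult_nonneg_nonneg)
  \<comment> \<open>Products of diagonal matrices are diagonal, so only signs on the diagonal remain
    to be checked.\<close>
  have off: "i \<noteq> j \<Longrightarrow> ?S$i$j = 0"
    "i \<noteq> j \<Longrightarrow> (?S ** korteweg_A0 \<rho> \<theta> p e)$i$j = 0"
    "i \<noteq> j \<Longrightarrow> (?S ** symbol_B (- korteweg_B \<theta> \<mu> \<alpha>) \<xi>)$i$j = 0" for i j
    using exhaust_3[of i] exhaust_3[of j]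
    by (auto simp: korteweg_S_def korteweg_A0_def korteweg_B_def symbol_B_def
        matrix_matrix_mult_def sum_3)
  show "pos_def_matrix ?S"
    using beta assms by (intro pos_def_matrix_diagonal_3 off) (simp_all add: korteweg_S_def)
  show "pos_def_matrix (?S ** korteweg_A0 \<rho> \<theta> p e)"
    using beta assms by (intro pos_def_matrix_diagonal_3 off)
      (simp_all add: korteweg_S_def korteweg_A0_def matrix_matrix_mult_def sum_3)
  \<comment> \<open>The two minus signs cancel, leaving \<xi>-squared times \<open>B\<close>. The
    first row is zero, hence semidefiniteness only.\<close>
  show "pos_semidef_matrix (?S ** symbol_B (- korteweg_B \<theta> \<mu> \<alpha>) \<xi>)"
    using assms by (intro pos_semidef_matrix_diagonal_3 off)
      (simp_all add: korteweg_S_def korteweg_B_def symbol_B_def matrix_matrix_mult_def sum_3)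
  \<comment> \<open>Entries (1,2) and (2,1) both equal \<beta>/\<theta>: the first is
    (\<beta>/p)(p/\<theta>), the second comes from \<open>A1\<close> plus the contribution of
    \<open>C\<close>. Entries (2,3) and (3,2) both stay q/\<theta>.\<close>
  show "sym_matrix (?S ** symbol_A (korteweg_A1 \<rho> u \<theta> p q e) (- korteweg_C \<rho> \<theta> k) \<xi>)"
    using assms
    by (simp add: sym_matrix_3 korteweg_S_def korteweg_beta_def korteweg_A1_def korteweg_C_def
        symbol_A_def matrix_matrix_mult_def sum_3 field_simps)
qed

text \<open>Symmetry of \<open>S C\<close> forces \<open>S\<^sub>2\<^sub>2 k \<rho> / \<theta> = 0\<close>, whereas \<open>S\<^sub>2\<^sub>2 > 0\<close>.\<close>

lemma korteweg_not_friedrichs_symmetrizable: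
  assumes "\<rho> \<noteq> 0" "\<theta> \<noteq> 0" "k \<noteq> 0"
  shows "\<not> friedrichs_symmetrizable A0 D1 D2 (- korteweg_C \<rho> \<theta> k)"
proof
  assume "friedrichs_symmetrizable A0 D1 D2 (- korteweg_C \<rho> \<theta> k)"
  then obtain S where S: "pos_def_matrix S" "sym_matrix (S ** - korteweg_C \<rho> \<theta> k)"
    by (auto simp: friedrichs_symmetrizable_def)
  from S(2) have "S$2$2 * (k * \<rho> / \<theta>) = 0"
    by (simp add: sym_matrix_3 korteweg_C_def matrix_matrix_mult_def sum_3)
  with assms pos_def_matrix_diag_pos[OF S(1), of 2] show False by simp
qed

theorem lemma4p2:
  fixes \<rho> u \<theta> p\<^sub>\<rho> p\<^sub>\<theta> e\<^sub>\<theta> \<mu> \<alpha> k :: real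
  assumes "\<rho> > 0" and "\<theta> > 0" and "p\<^sub>\<rho> > 0" and "p\<^sub>\<theta> > 0" and "e\<^sub>\<theta> > 0"
    and "\<mu> > 0" and "\<alpha> > 0" and "k > 0"
  shows "symbol_symmetrizable (korteweg_A0 \<rho> \<theta> p\<^sub>\<rho> e\<^sub>\<theta>)
           (korteweg_A1 \<rho> u \<theta> p\<^sub>\<rho> p\<^sub>\<theta> e\<^sub>\<theta>) (- korteweg_B \<theta> \<mu> \<alpha>) (- korteweg_C \<rho> \<theta> k)
       \<and> \<not> friedrichs_symmetrizable (korteweg_A0 \<rho> \<theta> p\<^sub>\<rho> e\<^sub>\<theta>)
           (korteweg_A1 \<rho> u \<theta> p\<^sub>\<rho> p\<^sub>\<theta> e\<^sub>\<theta>) (- korteweg_B \<theta> \<mu> \<alpha>) (- korteweg_C \<rho> \<theta> k)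
       \<and> symbol_symmetrizer (korteweg_A0 \<rho> \<theta> p\<^sub>\<rho> e\<^sub>\<theta>)
           (korteweg_A1 \<rho> u \<theta> p\<^sub>\<rho> p\<^sub>\<theta> e\<^sub>\<theta>) (- korteweg_B \<theta> \<mu> \<alpha>) (- korteweg_C \<rho> \<theta> k)
           (korteweg_S \<rho> p\<^sub>\<rho> k)"
  using assms korteweg_S_symbol_symmetrizer[of \<rho> \<theta> p\<^sub>\<rho> e\<^sub>\<theta> \<mu> \<alpha> k u p\<^sub>\<theta>]
  by (auto simp: symbol_symmetrizable_def korteweg_not_friedrichs_symmetrizable)

end
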